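(* Let $f(\cdot;i):\mathbb{R}^d\to\mathbb{R}$, $i\in[n]$, and $F(w)=\frac1n\sum_{i=1}^n f(w;i)$. Assume: (a) $\mathrm{dom}(F)\neq\emptyset$ and $F_*:=\inf_{w\in\mathbb{R}^d}F(w)>-\infty$; (b) there is $L>0$ such that for every $i\in[n]$ and all $w,w'\in\mathrm{dom}(F)$, $\|\nabla f(w;i)-\nabla f(w';i)\|\le L\|w-w'\|$; (c) there is $G>0$ such that $\|\nabla f(w;i)\|\le G$ for all $w\in\mathrm{dom}(F)$ and $i\in[n]$. Let $T\ge2$ and run the Single Shuffling Momentum Gradient algorithm (described in the context) with: $\beta:=\left(\frac{\nu}{T^{2/3}}\right)^{1/n}$ for some constant $\nu\ge0$ such that $\beta\le\left(\frac{R-1}{R}\right)^{1/n}$ for some $R\ge1$; and the diminishing learning rate $\eta_t:=\frac{\gamma}{(t+\lambda)^{1/3}}$ for all $t\in[T]$, for some $\gamma>0$ and $\lambda\ge0$ such that $\eta_1=\frac{\gamma}{(1+\lambda)^{1/3}}\le\frac1L$. Then $$\mathbb{E}\big[\|\nabla F(\hat w_T)\|^2\big]\le\frac{D_1}{(T+\lambda)^{2/3}-(1+\lambda)^{2/3}}+\frac{4\nu G^2R}{T^{2/3}}+\frac{L^2G^2\gamma^2\log(T-1+\lambda)}{(T+\lambda)^{2/3}-(1+\lambda)^{2/3}},$$ where $$D_1:=\frac{2R}{\gamma}[F(\tilde w_0)-F_*]+\left[\frac{R}{\gamma L}+\frac{R}{(1+\lambda)^{1/3}}\right]\|\nabla F(\tilde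 w_0)\|^2+\frac{2RL\gamma G^2}{(1+\lambda)^{2/3}}+\frac{2}{1+\lambda}L^2G^2\gamma^2.$$ Thus the convergence rate of the algorithm is $\mathcal{O}\left(\frac{\log(T)}{T^{2/3}}\right)$.
   Context: $[n]=\{1,\dots,n\}$; $\|\cdot\|$ is the Euclidean norm; $\log$ is the natural logarithm; $\mathbb{E}$ is expectation over all randomness (of the permutation, if random, and of the output). Since each $f(\cdot;i)$ is real-valued on $\mathbb{R}^d$, $\mathrm{dom}(F)=\mathbb{R}^d$; each $f(\cdot;i)$ is differentiable. Single Shuffling Momentum Gradient algorithm, with parameters $\beta$, number of epochs $T\ge1$, and $\eta_t$: Choose $\tilde w_0\in\mathbb{R}^d$ (deterministic) and set $\tilde m_0:=0$. Generate one permutation $\pi$ of $[n]$ (arbitrary), used at every epoch. For $t=1,\dots,T$: set $w_0^{(t)}:=\tilde w_{t-1}$, $m_0^{(t)}:=\tilde m_{t-1}$; for $i=0,\dots,n-1$ put $g_i^{(t)}:=\nabla f(w_i^{(t)};\pi(i+1))$ and $$m_{i+1}^{(t)}:=\beta m_i^{(t)}+(1-\beta)g_i^{(t)},\qquad w_{i+1}^{(t)}:=w_i^{(t)}-\tfrac{\eta_t}{n}m_{i+1}^{(t)};$$ then set $\tilde w_t:=w_n^{(t)}$ and $\tilde m_t:=m_n^{(t)}$. Output: $\hat w_T\in\{\tilde w_0,\dots,\tilde w_{T-1}\}$ chosen at random (independently of $\pi$) with probability $\mathbb{P}[\hat w_T=\tilde w_{t-1}]=\eta_t/\sum_{s=1}^T\eta_s$.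 *)

theory Defs
  imports "HOL-Probability.Probability" "HOL-Combinatorics.Permutations"
    "HOL-Library.Landau_Symbols"
begin

text \<open>Meaningful only where \<open>f\<close> is differentiable; otherwise the description is unspecified.\<close>

definition gradient :: "('a::euclidean_space \<Rightarrow> real) \<Rightarrow> 'a \<Rightarrow> 'a" where
  "gradient f w = (THE D. GDERIV f w :> D)"

definition objective :: "nat \<Rightarrow> (nat \<Rightarrow> 'a \<Rightarrow> real) \<Rightarrow> 'a \<Rightarrow> real" where
  "objective n f w = (\<Sum>i = 1..n. f i w) / real n"

text \<open>
  The state \<open>(w\<^sub>i, m\<^sub>i)\<close> after \<open>i\<close> steps of an epoch with learning rate \<open>h\<close>
  that was entered in state \<open>s\<close>.
\<close>

primrec smg_inner ::
  "nat \<Rightarrow> (nat \<Rightarrow> 'a::euclidean_space \<Rightarrow> real) \<Rightarrow> real \<Rightarrow> real \<Rightarrow> (nat \<Rightarrow> nat) \<Rightarrow> 'a \<times> 'a \<Rightarrow> nat \<Rightarrow> 'a \<times> 'a"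
where
  "smg_inner n f \<beta> h \<pi> s 0 = s"
| "smg_inner n f \<beta> h \<pi> s (Suc i) =
     (let (w, m) = smg_inner n f \<beta> h \<pi> s i;
          g = gradient (f (\<pi> (i + 1))) w;
          m' = \<beta> *\<^sub>R m + (1 - \<beta>) *\<^sub>R g
      in (w - (h / real n) *\<^sub>R m', m'))"

text \<open>
  The state after \<open>t\<close> epochs. Position and momentum are both carried over from one epoch to the
  next, and the same permutation \<open>\<pi>\<close> is used in every epoch.
\<close>

primrec smg_epoch ::
  "nat \<Rightarrow> (nat \<Rightarrow> 'a::euclidean_space \<Rightarrow> real) \<Rightarrow> real \<Rightarrow> (nat \<Rightarrow> real) \<Rightarrow> 'a \<Rightarrow> (nat \<Rightarrow> nat) \<Rightarrow> nat \<Rightarrow> 'a \<times> 'a"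
where
  "smg_epoch n f \<beta> \<eta> w0 \<pi> 0 = (w0, 0)"
| "smg_epoch n f \<beta> \<eta> w0 \<pi> (Suc t) =
     smg_inner n f \<beta> (\<eta> (Suc t)) \<pi> (smg_epoch n f \<beta> \<eta> w0 \<pi> t) n"

definition smg_iterate ::
  "nat \<Rightarrow> (nat \<Rightarrow> 'a::euclidean_space \<Rightarrow> real) \<Rightarrow> real \<Rightarrow> (nat \<Rightarrow> real) \<Rightarrow> 'a \<Rightarrow> (nat \<Rightarrow> nat) \<Rightarrow> nat \<Rightarrow> 'a"
where
  "smg_iterate n f \<beta> \<eta> w0 \<pi> t = fst (smg_epoch n f \<beta> \<eta> w0 \<pi> t)"

text \<open>
  The law of the random epoch number \<open>t\<close> in \<open>{1..T}\<close> whose starting point is returned. The weights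
  form a probability mass function only if \<open>T \<ge> 1\<close> and all \<open>\<eta> t\<close> are positive.
\<close>

definition smg_index_pmf :: "(nat \<Rightarrow> real) \<Rightarrow> nat \<Rightarrow> nat pmf" where
  "smg_index_pmf \<eta> T =
     embed_pmf (\<lambda>t. if t \<in> {1..T} then \<eta> t / (\<Sum>s = 1..T. \<eta> s) else 0)"

text \<open>
  The law of the output after \<open>T\<close> epochs. The permutation has law \<open>P\<close>, a point mass
  \<open>return_pmf \<pi>\<close> if it is deterministic, and \<open>pair_pmf\<close> makes the output index independent of it.
\<close>

definition smg_output ::
  "nat \<Rightarrow> (nat \<Rightarrow> 'a::euclidean_space \<Rightarrow> real) \<Rightarrow> real \<Rightarrow> (nat \<Rightarrow> real) \<Rightarrow> 'a \<Rightarrow> (nat \<Rightarrow> nat) pmf \<Rightarrow> nat \<Rightarrow> 'a pmf"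
where
  "smg_output n f \<beta> \<eta> w0 P T =
     map_pmf (\<lambda>(\<pi>, t). smg_iterate n f \<beta> \<eta> w0 \<pi> (t - 1)) (pair_pmf P (smg_index_pmf \<eta> T))"

end

theory Submission
  imports Defs "HOL-Real_Asymp.Real_Asymp"
begin

text \<open>
  Write \<open>d\<^sub>t\<close> for the mean of the \<open>n\<close> momentum vectors computed in epoch \<open>t\<close>, so that a whole epoch is
  one inexact gradient step \<open>w\<^sub>t = w\<^sub>t\<^sub>-\<^sub>1 - \<eta>\<^sub>t d\<^sub>t\<close> for \<open>F\<close>. For an \<open>L\<close>-smooth \<open>F\<close> and \<open>\<eta>\<^sub>t \<le> 1 / L\<close>
  the descent lemma gives
  \<open>2 F(w\<^sub>t) + \<eta>\<^sub>t \<parallel>\<nabla>F(w\<^sub>t\<^sub>-\<^sub>1)\<parallel>\<^sup>2 \<le> 2 F(w\<^sub>t\<^sub>-\<^sub>1) + \<eta>\<^sub>t \<parallel>\<nabla>F(w\<^sub>t\<^sub>-\<^sub>1) - d\<^sub>t\<parallel>\<^sup>2\<close>,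
  so everything depends on how far \<open>d\<^sub>t\<close> is from the full gradient.

  Unrolling the momentum recursion over exactly \<open>n\<close> steps expresses each momentum vector as
  \<open>\<beta>\<^sup>n\<close> times the one at the same position of the previous epoch plus a weighted sum, with weights
  \<open>(1 - \<beta>) \<beta>\<^sup>j\<close>, of the last \<open>n\<close> component gradients. Since every epoch uses the same permutation,
  after averaging over the epoch each weight multiplies the mean of \<open>n\<close> consecutive component
  gradients in which every component occurs exactly once (\<open>d_Suc\<close>). All of these are evaluated at
  points within \<open>\<eta>\<^sub>t\<^sub>-\<^sub>1 G\<close> of \<open>w\<^sub>t\<^sub>-\<^sub>1\<close>, so each mean is within \<open>L G \<eta>\<^sub>t\<^sub>-\<^sub>1\<close> of \<open>\<nabla>F(w\<^sub>t\<^sub>-\<^sub>1)\<close>. Hence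
  \<open>\<nabla>F(w\<^sub>t\<^sub>-\<^sub>1) - d\<^sub>t\<close> is a convex combination with weights \<open>\<beta>\<^sup>n\<close> and \<open>1 - \<beta>\<^sup>n\<close> of vectors of norm at
  most \<open>2 G\<close> and \<open>L G \<eta>\<^sub>t\<^sub>-\<^sub>1\<close>, and convexity of the square bounds its square by
  \<open>4 \<beta>\<^sup>n G\<^sup>2 + L\<^sup>2 G\<^sup>2 \<eta>\<^sub>t\<^sub>-\<^sub>1\<^sup>2\<close> (\<open>direction_error\<close>). The first epoch has no predecessor and is
  estimated crudely (\<open>first_epoch\<close>), which produces the terms in \<open>\<parallel>\<nabla>F(w\<^sub>0)\<parallel>\<^sup>2\<close>.

  Summing over the epochs (\<open>weighted_gradient_sum_le\<close>) gives a bound for every permutation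
  separately; as the output index is independent of the permutation, dividing by \<open>\<Sum>\<eta>\<^sub>t\<close> bounds the
  expectation. For \<open>\<eta>\<^sub>t = \<gamma> / (t + \<lambda>)\<^bsup>1/3\<^esup>\<close> that sum is at least
  \<open>\<gamma> ((T + \<lambda>)\<^bsup>2/3\<^esup> - (1 + \<lambda>)\<^bsup>2/3\<^esup>)\<close> by telescoping, and \<open>\<Sum>\<eta>\<^sub>t\<^sub>-\<^sub>1\<^sup>3\<close> is \<open>\<gamma>\<^sup>3\<close> times a piece of the harmonic
  series. The resulting estimate does not involve \<open>R\<close> and needs only \<open>\<beta> \<le> 1\<close>, which holds for all
  sufficiently large numbers of epochs; this yields the asymptotic rate.
\<close>

section \<open>Gradients and the descent lemma\<close>

lemma gradient_eqI:
  assumes "GDERIV f w :> D"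
  shows "gradient f w = D"
proof -
  have "E = D" if "GDERIV f w :> E" for E
  proof -
    have "(\<lambda>h. inner h E) = (\<lambda>h. inner h D)"
      using that assms unfolding gderiv_def by (rule has_derivative_unique)
    then have "inner h (E - D) = 0" for h
      by (metis inner_diff_right right_minus_eq)
    from this[of "E - D"] show "E = D"
      by simp
  qed
  with assms show ?thesis
    unfolding gradient_def by (intro the_equality)
qed

lemma GDERIV_gradient:
  fixes f :: "'a::euclidean_space \<Rightarrow> real"
  assumes "f differentiable (at w)"
  shows "GDERIV f w :> gradient f w"
proof -
  obtain f' where f': "(f has_derivative f') (at w)"
    using assms unfolding differentiable_def by blast
  then have "linear f'"
    by (rule has_derivative_linear)
  \<comment> \<open>The Riesz representative of the derivative.\<close>
  define D where "D = (\<Sum>b\<in>Basis. f' b *\<^sub>R b)"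
  have "f' h = inner h D" for h
  proof -
    have "f' h = f' (\<Sum>b\<in>Basis. (h \<bullet> b) *\<^sub>R b)"
      by (simp add: euclidean_representation)
    also have "\<dots> = inner h D"
      using \<open>linear f'\<close> by (simp add: D_def linear_sum linear_scale inner_sum_right mult.commute)
    finally show ?thesis .
  qed
  then have "GDERIV f w :> D"
    using f' by (simp add: gderiv_def ext[of f' "\<lambda>h. inner h D"])
  then show ?thesis
    by (simp add: gradient_eqI)
qed

lemma descent_lemma:
  fixes F :: "'a::euclidean_space \<Rightarrow> real"
  assumes deriv: "\<And>w. GDERIV F w :> F' w"
    and lip: "\<And>w w'. norm (F' w - F' w') \<le> L * norm (w - w')"
  shows "F (w + v) \<le> F w + inner (F' w) v + L / 2 * (norm v)\<^sup>2"
proof -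
  \<comment> \<open>Up to a constant, the excess of \<open>F\<close> over its quadratic model along the segment from \<open>w\<close> to
    \<open>w + v\<close>; it is nonincreasing.\<close>
  define \<phi> where "\<phi> t = F (w + t *\<^sub>R v) - t * inner (F' w) v - L / 2 * t\<^sup>2 * (norm v)\<^sup>2" for t :: real
  have slope: "\<exists>y. DERIV \<phi> t :> y \<and> y \<le> 0" if "0 \<le> t" for t
  proof (intro exI conjI)
    have line: "((\<lambda>t. w + t *\<^sub>R v) has_derivative (\<lambda>s. s *\<^sub>R v)) (at t)"
      by (auto intro!: derivative_eq_intros)
    have "((\<lambda>t. F (w + t *\<^sub>R v)) has_derivative (\<lambda>s. inner (s *\<^sub>R v) (F' (w + t *\<^sub>R v)))) (at t)"
      using has_derivative_compose[OF line deriv[unfolded gderiv_def]] .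
    then have along: "DERIV (\<lambda>t. F (w + t *\<^sub>R v)) t :> inner v (F' (w + t *\<^sub>R v))"
      by (simp only: has_field_derivative_def inner_scaleR_left mult_commute_abs)
    have lin: "DERIV (\<lambda>t. t * inner (F' w) v) t :> inner (F' w) v"
      by (auto intro!: derivative_eq_intros)
    have quad: "DERIV (\<lambda>t. L / 2 * t\<^sup>2 * (norm v)\<^sup>2) t :> L * t * (norm v)\<^sup>2"
      by (auto intro!: derivative_eq_intros)
    show "DERIV \<phi> t :> inner v (F' (w + t *\<^sub>R v)) - inner (F' w) v - L * t * (norm v)\<^sup>2"
      unfolding \<phi>_def using DERIV_diff[OF DERIV_diff[OF along lin] quad] .
    have "inner v (F' (w + t *\<^sub>R v) - F' w) \<le> norm v * norm (F' (w + t *\<^sub>R v) - F' w)"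
      by (rule norm_cauchy_schwarz)
    also have "\<dots> \<le> norm v * (L * norm (t *\<^sub>R v))"
      using lip[of "w + t *\<^sub>R v" w] by (intro mult_left_mono) auto
    also have "\<dots> = L * t * (norm v)\<^sup>2"
      using that by (simp add: power2_eq_square)
    finally show "inner v (F' (w + t *\<^sub>R v)) - inner (F' w) v - L * t * (norm v)\<^sup>2 \<le> 0"
      by (simp add: inner_diff_right inner_commute)
  qed
  have "\<phi> 1 \<le> \<phi> 0"
    by (rule DERIV_nonpos_imp_nonincreasing) (simp, rule slope)
  then show ?thesis
    by (simp add: \<phi>_def)
qed

section \<open>Smooth finite sums\<close>

text \<open>
  The standing assumptions on the component functions: differentiability, and gradients that are
  \<open>L\<close>-Lipschitz and bounded by \<open>G\<close>, uniformly in the component.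
\<close>

locale smooth_finite_sum =
  fixes n :: nat and f :: "nat \<Rightarrow> 'a::euclidean_space \<Rightarrow> real" and L G :: real
  assumes n_pos: "n \<ge> 1"
    and differentiable: "\<And>i w. i \<in> {1..n} \<Longrightarrow> f i differentiable (at w)"
    and L_pos: "L > 0"
    and lipschitz: "\<And>i w w'. i \<in> {1..n} \<Longrightarrow>
      norm (gradient (f i) w - gradient (f i) w') \<le> L * norm (w - w')"
    and G_pos: "G > 0"
    and bounded_gradient: "\<And>i w. i \<in> {1..n} \<Longrightarrow> norm (gradient (f i) w) \<le> G"
begin

abbreviation F :: "'a \<Rightarrow> real" where
  "F \<equiv> objective n f"

lemma GDERIV_objective: "GDERIV F w :> (1 / real n) *\<^sub>R (\<Sum>i = 1..n. gradient (f i) w)"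
proof -
  have "GDERIV (f i) w :> gradient (f i) w" if "i \<in> {1..n}" for i
    using that differentiable by (intro GDERIV_gradient)
  then have "((\<lambda>w. (1 / real n) * (\<Sum>i = 1..n. f i w)) has_derivative
      (\<lambda>h. (1 / real n) * (\<Sum>i = 1..n. inner h (gradient (f i) w)))) (at w)"
    unfolding gderiv_def by (intro has_derivative_mult_right has_derivative_sum) auto
  moreover have "(\<lambda>w. (1 / real n) * (\<Sum>i = 1..n. f i w)) = F"
    by (simp add: objective_def fun_eq_iff)
  ultimately show ?thesis
    by (simp add: gderiv_def inner_sum_right)
qed

lemma gradient_objective: "gradient F w = (1 / real n) *\<^sub>R (\<Sum>i = 1..n. gradient (f i) w)"
  by (intro gradient_eqI GDERIV_objective)

lemma norm_mean_le:
  fixes v :: "'b \<Rightarrow> 'c::real_normed_vector"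
  assumes "card I = n" "\<And>i. i \<in> I \<Longrightarrow> norm (v i) \<le> B"
  shows "norm ((1 / real n) *\<^sub>R (\<Sum>i\<in>I. v i)) \<le> B"
proof -
  have "norm (\<Sum>i\<in>I. v i) \<le> real n * B"
    using sum_norm_bound[of I v B] assms by simp
  then show ?thesis
    using n_pos by (simp add: divide_simps mult.commute)
qed

lemma bounded_gradient_objective: "norm (gradient F w) \<le> G"
  unfolding gradient_objective by (rule norm_mean_le) (auto simp: bounded_gradient)

lemma lipschitz_gradient_objective: "norm (gradient F w - gradient F w') \<le> L * norm (w - w')"
proof -
  have "gradient F w - gradient F w' =
      (1 / real n) *\<^sub>R (\<Sum>i = 1..n. gradient (f i) w - gradient (f i) w')"
    by (simp add: gradient_objective sum_subtractf scaleR_diff_right)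
  then show ?thesis
    by (simp only:) (rule norm_mean_le, auto simp: lipschitz)
qed

lemma objective_descent:
  "F (w - h *\<^sub>R d) \<le> F w - h * inner (gradient F w) d + L / 2 * h\<^sup>2 * (norm d)\<^sup>2"
  using descent_lemma[of F "gradient F" L w "- (h *\<^sub>R d)"] GDERIV_objective
    lipschitz_gradient_objective
  by (simp add: gradient_objective power_mult_distrib)

text \<open>
  One step along an arbitrary direction \<open>d\<close>, seen as a gradient step with error \<open>gradient F w - d\<close>.
  The condition \<open>h \<le> 1 / L\<close> makes the quadratic term of the descent lemma harmless.
\<close>

lemma objective_descent_inexact:
  assumes "0 \<le> h" "h \<le> 1 / L"
  shows "2 * F (w - h *\<^sub>R d) + h * (norm (gradient F w))\<^sup>2 \<le>
    2 * F w + h * (norm (gradient F w - d))\<^sup>2"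
proof -
  have "h * L \<le> 1"
    using assms(2) L_pos by (simp add: field_simps)
  then have "h * (h * L) * (norm d)\<^sup>2 \<le> h * 1 * (norm d)\<^sup>2"
    using assms(1) by (intro mult_right_mono mult_left_mono) auto
  then have "L * h\<^sup>2 * (norm d)\<^sup>2 \<le> h * (norm d)\<^sup>2"
    by (simp add: power2_eq_square mult.assoc mult.left_commute)
  moreover have "h * (norm (gradient F w - d))\<^sup>2 =
      h * (norm (gradient F w))\<^sup>2 - 2 * (h * inner (gradient F w) d) + h * (norm d)\<^sup>2"
    by (simp add: power2_norm_eq_inner inner_diff_left inner_diff_right inner_commute
        algebra_simps)
  ultimately show ?thesis
    using objective_descent[of w h d] by simp
qed

end

section \<open>A run with a fixed permutation\<close>

lemma sum_shift_mod:
  fixes a :: "nat \<Rightarrow> 'b::comm_monoid_add"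
  assumes "n > 0"
  shows "(\<Sum>i<n. a ((c + i) mod n)) = (\<Sum>i<n. a i)"
proof (induction c)
  case 0
  show ?case by simp
next
  case (Suc c)
  obtain k where n: "n = Suc k"
    using assms gr0_implies_Suc by blast
  have "(\<Sum>i<n. a ((Suc c + i) mod n)) = (\<Sum>i<k. a ((c + Suc i) mod n)) + a (c mod n)"
  proof -
    have "(Suc c + k) mod n = c mod n"
      using n by (metis add_Suc_shift mod_add_self2)
    then show ?thesis
      unfolding n sum.lessThan_Suc by (simp flip: n)
  qed
  also have "\<dots> = (\<Sum>i<n. a ((c + i) mod n))"
    unfolding n sum.lessThan_Suc_shift by (simp add: add.commute)
  finally show ?case
    using Suc by simp
qed

text \<open>
  A deterministic run of the method. Of the step sizes \<open>\<eta> t\<close>, only those with \<open>t \<ge> 1\<close> are used.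
\<close>

locale smg_run = smooth_finite_sum n f L G
  for n :: nat and f :: "nat \<Rightarrow> 'a::euclidean_space \<Rightarrow> real" and L G :: real +
  fixes \<beta> :: real and \<eta> :: "nat \<Rightarrow> real" and w0 :: 'a and \<pi> :: "nat \<Rightarrow> nat"
  assumes beta_nonneg: "0 \<le> \<beta>" and beta_le_1: "\<beta> \<le> 1"
    and eta_pos: "\<And>t. t \<ge> 1 \<Longrightarrow> \<eta> t > 0"
    and eta_antimono: "\<And>s t. 1 \<le> s \<Longrightarrow> s \<le> t \<Longrightarrow> \<eta> t \<le> \<eta> s"
    and perm: "\<pi> permutes {1..n}"
begin

text \<open>
  All inner steps of all epochs are numbered consecutively: \<open>state k\<close> is the pair of position and
  momentum after \<open>k\<close> inner steps in total, that is, after \<open>k mod n\<close> steps of epoch number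
  \<open>Suc (k div n)\<close>. The momentum recursion then ignores the epoch boundaries.
\<close>

definition state :: "nat \<Rightarrow> 'a \<times> 'a" where
  "state k = smg_inner n f \<beta> (\<eta> (Suc (k div n))) \<pi> (smg_epoch n f \<beta> \<eta> w0 \<pi> (k div n)) (k mod n)"

text \<open>
  The position after \<open>k\<close> inner steps in total.
\<close>

definition x :: "nat \<Rightarrow> 'a" where
  "x k = fst (state k)"

text \<open>
  The momentum after \<open>k\<close> inner steps in total.
\<close>

definition m :: "nat \<Rightarrow> 'a" where
  "m k = snd (state k)"

text \<open>
  The component gradient used in the inner step from \<open>state k\<close> to \<open>state (Suc k)\<close>.
\<close>

definition g :: "nat \<Rightarrow> 'a" where
  "g k = gradient (f (\<pi> (k mod n + 1))) (x k)"

text \<open>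
  The mean of the momentum vectors \<open>m\<close> with indices \<open>s * n + 1, \<dots>, s * n + n\<close>, which are those of
  epoch \<open>Suc s\<close>. It is the search direction of that epoch as a whole; see \<open>x_epoch_Suc\<close> below.
\<close>

definition d :: "nat \<Rightarrow> 'a" where
  "d s = (1 / real n) *\<^sub>R (\<Sum>i<n. m (s * n + i + 1))"

lemma state_epoch: "state (t * n) = smg_epoch n f \<beta> \<eta> w0 \<pi> t"
  using n_pos by (simp add: state_def)

lemma iterate_eq_x: "smg_iterate n f \<beta> \<eta> w0 \<pi> t = x (t * n)"
  by (simp add: smg_iterate_def x_def state_epoch)

text \<open>
  The one case with content is the last step of an epoch: the final state of an epoch, reached after
  \<open>n\<close> inner steps, is the initial state of the next one.
\<close>

lemma state_Suc:
  "state (Suc k) = smg_inner n f \<beta> (\<eta> (Suc (k div n))) \<pi>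
     (smg_epoch n f \<beta> \<eta> w0 \<pi> (k div n)) (Suc (k mod n))"
proof (cases "Suc (k mod n) = n")
  case True
  then have "Suc k div n = Suc (k div n)" "Suc k mod n = 0"
    using n_pos by (simp_all add: div_Suc mod_Suc)
  then show ?thesis
    using True by (simp add: state_def del: smg_inner.simps(2))
next
  case False
  then have "Suc k div n = k div n" "Suc k mod n = Suc (k mod n)"
    by (simp_all add: div_Suc mod_Suc)
  then show ?thesis
    by (simp add: state_def del: smg_inner.simps(2))
qed

lemma m_Suc: "m (Suc k) = \<beta> *\<^sub>R m k + (1 - \<beta>) *\<^sub>R g k"
  unfolding m_def state_Suc by (simp add: g_def x_def Let_def split_beta flip: state_def)

lemma x_Suc: "x (Suc k) = x k - (\<eta> (Suc (k div n)) / real n) *\<^sub>R m (Suc k)"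
  unfolding m_Suc unfolding x_def state_Suc
  by (simp add: g_def x_def m_def Let_def split_beta flip: state_def)

lemma m_0: "m 0 = 0" and x_0: "x 0 = w0"
  using state_epoch[of 0] by (simp_all add: m_def x_def)

lemma perm_index: "\<pi> (k mod n + 1) \<in> {1..n}"
  using permutes_in_image[OF perm, of "k mod n + 1"] n_pos by (simp add: Suc_le_eq)

lemma norm_g: "norm (g k) \<le> G"
  unfolding g_def by (rule bounded_gradient[OF perm_index])

lemma norm_m: "norm (m k) \<le> G"
proof (induction k)
  case 0
  show ?case using G_pos by (simp add: m_0)
next
  case (Suc k)
  have "norm (m (Suc k)) \<le> \<beta> * norm (m k) + (1 - \<beta>) * norm (g k)"
    using norm_triangle_ineq[of "\<beta> *\<^sub>R m k" "(1 - \<beta>) *\<^sub>R g k"] beta_nonneg beta_le_1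
    by (simp add: m_Suc)
  also have "\<dots> \<le> \<beta> * G + (1 - \<beta>) * G"
    using Suc norm_g beta_nonneg beta_le_1 by (intro add_mono mult_left_mono) auto
  finally show ?case by (simp add: algebra_simps)
qed

lemma norm_d: "norm (d s) \<le> G"
  unfolding d_def by (rule norm_mean_le) (auto simp: norm_m)

lemma m_window: "m (k + j) = \<beta> ^ j *\<^sub>R m k + (1 - \<beta>) *\<^sub>R (\<Sum>i<j. \<beta> ^ i *\<^sub>R g (k + j - 1 - i))"
proof (induction j)
  case (Suc j)
  have "(\<Sum>i<Suc j. \<beta> ^ i *\<^sub>R g (k + Suc j - 1 - i)) =
      g (k + j) + \<beta> *\<^sub>R (\<Sum>i<j. \<beta> ^ i *\<^sub>R g (k + j - 1 - i))"
    unfolding sum.lessThan_Suc_shift by (simp add: scaleR_sum_right)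
  then show ?case
    using Suc by (simp only: add_Suc_right m_Suc) (simp add: scaleR_add_right mult.commute)
qed simp

lemma x_epoch_Suc: "x (Suc s * n) = x (s * n) - \<eta> (Suc s) *\<^sub>R d s"
proof -
  have "x (s * n + j) = x (s * n) - (\<eta> (Suc s) / real n) *\<^sub>R (\<Sum>i<j. m (s * n + i + 1))"
    if "j \<le> n" for j
    using that
  proof (induction j)
    case (Suc j)
    then have "(s * n + j) div n = s" by simp
    then show ?case
      using Suc by (simp add: x_Suc scaleR_add_right)
  qed simp
  from this[of n] show ?thesis
    by (simp add: d_def add.commute)
qed

lemma norm_x_diff_le:
  assumes "k \<le> l" "s * n \<le> k"
  shows "norm (x l - x k) \<le> real (l - k) * (\<eta> (Suc s) * G / real n)"
  using assms(1)
proof (induction l rule: dec_induct)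
  case (step l)
  have "s \<le> l div n"
    using assms(2) step n_pos by (simp add: less_eq_div_iff_mult_less_eq)
  then have "\<eta> (Suc (l div n)) * norm (m (Suc l)) \<le> \<eta> (Suc s) * G"
    using eta_pos[of "Suc s"] by (intro mult_mono eta_antimono norm_m) auto
  then have "norm (x (Suc l) - x l) \<le> \<eta> (Suc s) * G / real n"
    using n_pos eta_pos[of "Suc (l div n)"] by (simp add: x_Suc divide_right_mono)
  moreover have "norm (x (Suc l) - x k) \<le> norm (x (Suc l) - x l) + norm (x l - x k)"
    by norm
  moreover have "real (Suc l - k) = real (l - k) + 1"
    using step by (simp add: Suc_diff_le)
  ultimately show ?case
    using step.IH by (simp only: distrib_right)
qed simp

text \<open>
  Positions in the two epochs adjacent to the end point \<open>x (Suc s * n)\<close> of epoch \<open>Suc s\<close> are at most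
  \<open>n\<close> inner steps away from it, and none of these steps uses a rate larger than \<open>\<eta> (Suc s)\<close>.
\<close>

lemma norm_x_near_epoch_le:
  assumes "s * n \<le> k" "k \<le> Suc (Suc s) * n"
  shows "norm (x k - x (Suc s * n)) \<le> \<eta> (Suc s) * G"
proof -
  have pos: "0 \<le> \<eta> (Suc s) * G / real n"
    using eta_pos[of "Suc s"] G_pos by simp
  have fin: "y \<le> \<eta> (Suc s) * G" if "y \<le> real i * (\<eta> (Suc s) * G / real n)" "i \<le> n" for y i
  proof -
    have "y \<le> real n * (\<eta> (Suc s) * G / real n)"
      using that pos by (meson mult_right_mono of_nat_le_iff order_trans)
    then show ?thesis using n_pos by simp
  qed
  show ?thesis
  proof (cases "k \<le> Suc s * n")
    case True
    show ?thesis
      using norm_x_diff_le[OF True assms(1)] assms(1)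
      by (intro fin[of _ "Suc s * n - k"]) (auto simp: norm_minus_commute)
  next
    case False
    then show ?thesis
      using norm_x_diff_le[of "Suc s * n" k s] assms(2)
      by (intro fin[of _ "k - Suc s * n"]) auto
  qed
qed

text \<open>
  Any \<open>n\<close> consecutive inner steps, also across an epoch boundary, use every component exactly once,
  because the permutation does not change between epochs.
\<close>

lemma gradient_objective_period:
  "gradient F y = (1 / real n) *\<^sub>R (\<Sum>i<n. gradient (f (\<pi> ((c + i) mod n + 1))) y)"
proof -
  have "(\<Sum>i<n. gradient (f (\<pi> ((c + i) mod n + 1))) y) = (\<Sum>i<n. gradient (f (\<pi> (i + 1))) y)"
    using n_pos by (intro sum_shift_mod) auto
  also have "\<dots> = (\<Sum>i = 1..n. gradient (f (\<pi> i)) y)"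
    by (simp add: sum.atLeast1_atMost_eq)
  also have "\<dots> = (\<Sum>i = 1..n. gradient (f i) y)"
    using sum.permute[OF perm, of "\<lambda>i. gradient (f i) y"] by (simp add: o_def)
  finally show ?thesis
    by (simp add: gradient_objective)
qed

lemma norm_period_error_le:
  assumes "s * n \<le> c" "c \<le> Suc s * n"
  shows "norm (gradient F (x (Suc s * n)) - (1 / real n) *\<^sub>R (\<Sum>i<n. g (c + i)))
    \<le> L * (\<eta> (Suc s) * G)"
proof -
  let ?y = "x (Suc s * n)"
  have "norm (gradient (f (\<pi> ((c + i) mod n + 1))) ?y - g (c + i)) \<le> L * (\<eta> (Suc s) * G)"
    if "i < n" for i
  proof -
    have "norm (x (c + i) - ?y) \<le> \<eta> (Suc s) * G"
      using assms that by (intro norm_x_near_epoch_le) auto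
    then have "L * norm (?y - x (c + i)) \<le> L * (\<eta> (Suc s) * G)"
      using L_pos by (simp add: norm_minus_commute)
    then show ?thesis
      unfolding g_def using lipschitz[OF perm_index] order_trans by blast
  qed
  then have "norm ((1 / real n) *\<^sub>R
      (\<Sum>i<n. gradient (f (\<pi> ((c + i) mod n + 1))) ?y - g (c + i))) \<le> L * (\<eta> (Suc s) * G)"
    by (intro norm_mean_le) auto
  then show ?thesis
    unfolding gradient_objective_period[of ?y c] by (simp only: sum_subtractf scaleR_diff_right)
qed

text \<open>
  Unrolling the momentum by \<open>n\<close> steps and averaging over the epoch. For each weight \<open>\<beta> ^ j\<close> the
  gradients are collected into a window of \<open>n\<close> consecutive steps, starting \<open>j\<close> steps before the epoch.
\<close>

lemma d_Suc:
  "d (Suc s) = \<beta> ^ n *\<^sub>R d s +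
     (1 - \<beta>) *\<^sub>R (\<Sum>j<n. \<beta> ^ j *\<^sub>R ((1 / real n) *\<^sub>R (\<Sum>i<n. g (Suc s * n - j + i))))"
proof -
  have "m (Suc s * n + i + 1) = \<beta> ^ n *\<^sub>R m (s * n + i + 1) +
      (1 - \<beta>) *\<^sub>R (\<Sum>j<n. \<beta> ^ j *\<^sub>R g (Suc s * n - j + i))" for i
  proof -
    have "(\<Sum>j<n. \<beta> ^ j *\<^sub>R g (s * n + i + 1 + n - 1 - j)) =
        (\<Sum>j<n. \<beta> ^ j *\<^sub>R g (Suc s * n - j + i))"
    proof (intro sum.cong refl)
      fix j assume "j \<in> {..<n}"
      then have "s * n + i + 1 + n - 1 - j = Suc s * n - j + i"
        by auto
      then show "\<beta> ^ j *\<^sub>R g (s * n + i + 1 + n - 1 - j) = \<beta> ^ j *\<^sub>R g (Suc s * n - j + i)"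
        by (simp only:)
    qed
    moreover have "s * n + i + 1 + n = Suc s * n + i + 1"
      by simp
    ultimately show ?thesis
      using m_window[of "s * n + i + 1" n] by (simp only:)
  qed
  then have "d (Suc s) = (1 / real n) *\<^sub>R (\<Sum>i<n. \<beta> ^ n *\<^sub>R m (s * n + i + 1)) +
      (1 / real n) *\<^sub>R (1 - \<beta>) *\<^sub>R (\<Sum>i<n. \<Sum>j<n. \<beta> ^ j *\<^sub>R g (Suc s * n - j + i))"
    by (simp add: d_def sum.distrib scaleR_add_right scaleR_sum_right)
  also have "(\<Sum>i<n. \<Sum>j<n. \<beta> ^ j *\<^sub>R g (Suc s * n - j + i)) =
      (\<Sum>j<n. \<beta> ^ j *\<^sub>R (\<Sum>i<n. g (Suc s * n - j + i)))"
    by (subst sum.swap) (simp add: scaleR_sum_right)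
  finally show ?thesis
    by (simp add: d_def scaleR_sum_right ac_simps)
qed

text \<open>
  The deviation of the search direction from the full gradient consists of the stale part, of weight
  \<open>\<beta> ^ n\<close> and at most \<open>2 * G\<close>, and of the gradients of the last \<open>n\<close> steps, of total weight
  \<open>1 - \<beta> ^ n\<close> and evaluated close to the start of the epoch.
\<close>

lemma direction_error:
  "(norm (gradient F (x (Suc s * n)) - d (Suc s)))\<^sup>2
     \<le> 4 * \<beta> ^ n * G\<^sup>2 + L\<^sup>2 * G\<^sup>2 * (\<eta> (Suc s))\<^sup>2"
proof -
  define b where "b = \<beta> ^ n"
  define D where "D = gradient F (x (Suc s * n))"
  define v where "v j = (1 / real n) *\<^sub>R (\<Sum>i<n. g (Suc s * n - j + i))" for j
  define E where "E = L * (\<eta> (Suc s) * G)"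
  have b: "0 \<le> b" "b \<le> 1"
    using beta_nonneg beta_le_1 by (auto simp: b_def power_le_one)
  have geom: "1 - b = (1 - \<beta>) * (\<Sum>j<n. \<beta> ^ j)"
    by (simp add: b_def one_diff_power_eq)
  have "norm (D - v j) \<le> E" if "j < n" for j
    unfolding D_def v_def E_def using that by (intro norm_period_error_le) auto
  then have "norm (\<beta> ^ j *\<^sub>R (D - v j)) \<le> \<beta> ^ j * E" if "j < n" for j
    using that beta_nonneg by (simp add: mult_left_mono)
  then have "norm (\<Sum>j<n. \<beta> ^ j *\<^sub>R (D - v j)) \<le> (\<Sum>j<n. \<beta> ^ j * E)"
    by (intro sum_norm_le) auto
  then have "(1 - \<beta>) * norm (\<Sum>j<n. \<beta> ^ j *\<^sub>R (D - v j)) \<le> (1 - \<beta>) * (\<Sum>j<n. \<beta> ^ j * E)"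
    using beta_le_1 by (intro mult_left_mono) auto
  then have fresh: "norm ((1 - \<beta>) *\<^sub>R (\<Sum>j<n. \<beta> ^ j *\<^sub>R (D - v j))) \<le> (1 - b) * E"
    using beta_le_1 by (simp add: geom mult.assoc flip: sum_distrib_right)
  have "D = b *\<^sub>R D + (1 - b) *\<^sub>R D"
    by (simp add: algebra_simps)
  also have "(1 - b) *\<^sub>R D = (1 - \<beta>) *\<^sub>R (\<Sum>j<n. \<beta> ^ j *\<^sub>R D)"
    by (simp only: geom scaleR_sum_left flip: scaleR_scaleR)
  finally have "D - d (Suc s) = b *\<^sub>R (D - d s) + (1 - \<beta>) *\<^sub>R (\<Sum>j<n. \<beta> ^ j *\<^sub>R (D - v j))"
    by (simp add: d_Suc b_def v_def scaleR_diff_right sum_subtractf)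
  then have "norm (D - d (Suc s)) \<le> b * norm (D - d s) + (1 - b) * E"
    using norm_triangle_ineq[of "b *\<^sub>R (D - d s)" "(1 - \<beta>) *\<^sub>R (\<Sum>j<n. \<beta> ^ j *\<^sub>R (D - v j))"]
      fresh b by simp
  then have "(norm (D - d (Suc s)))\<^sup>2 \<le> (b * norm (D - d s) + (1 - b) * E)\<^sup>2"
    by (intro power_mono) auto
  \<comment> \<open>Convexity of the square.\<close>
  also have "\<dots> \<le> b * (norm (D - d s))\<^sup>2 + (1 - b) * E\<^sup>2"
  proof -
    have "b * (norm (D - d s))\<^sup>2 + (1 - b) * E\<^sup>2 - (b * norm (D - d s) + (1 - b) * E)\<^sup>2
        = b * (1 - b) * (norm (D - d s) - E)\<^sup>2"
      by (simp add: power2_eq_square algebra_simps)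
    moreover have "0 \<le> b * (1 - b) * (norm (D - d s) - E)\<^sup>2"
      using b by simp
    ultimately show ?thesis by linarith
  qed
  also have "\<dots> \<le> b * (2 * G)\<^sup>2 + 1 * E\<^sup>2"
  proof -
    have "(1 - b) * E\<^sup>2 \<le> 1 * E\<^sup>2"
      using b by (intro mult_right_mono) auto
    moreover
    have "norm (D - d s) \<le> 2 * G"
      using norm_triangle_ineq4[of D "d s"] norm_d[of s] bounded_gradient_objective
      unfolding D_def by (smt (verit))
    ultimately show ?thesis
      using b by (intro add_mono mult_left_mono power_mono) auto
  qed
  finally show ?thesis
    by (simp add: b_def D_def E_def power_mult_distrib ac_simps)
qed

text \<open>
  The momentum starts at zero, so \<open>d 0\<close> need not be close to the gradient. Only \<open>norm (d 0) \<le> G\<close> is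
  used, and the mixed term is split by Young's inequality.
\<close>

lemma first_epoch:
  "2 * F (x n) \<le> 2 * F w0 + (norm (gradient F w0))\<^sup>2 / L + 2 * L * (\<eta> 1)\<^sup>2 * G\<^sup>2"
proof -
  define a where "a = norm (gradient F w0)"
  have eta: "\<eta> 1 > 0"
    by (simp add: eta_pos)
  have "- (\<eta> 1 * inner (gradient F w0) (d 0)) \<le> \<eta> 1 * (a * G)"
  proof -
    have "- inner (gradient F w0) (d 0) \<le> a * norm (d 0)"
      using Cauchy_Schwarz_ineq2[of "gradient F w0" "d 0"] by (simp add: a_def)
    also have "\<dots> \<le> a * G"
      using norm_d by (intro mult_left_mono) (auto simp: a_def)
    finally have "\<eta> 1 * (- inner (gradient F w0) (d 0)) \<le> \<eta> 1 * (a * G)"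
      using eta by (intro mult_left_mono) auto
    then show ?thesis by simp
  qed
  moreover have "L / 2 * (\<eta> 1)\<^sup>2 * (norm (d 0))\<^sup>2 \<le> L / 2 * (\<eta> 1)\<^sup>2 * G\<^sup>2"
    using L_pos norm_d by (intro mult_left_mono power_mono) auto
  moreover have "x n = w0 - \<eta> 1 *\<^sub>R d 0"
    using x_epoch_Suc[of 0] by (simp add: x_0)
  ultimately have "2 * F (x n) \<le> 2 * F w0 + 2 * (\<eta> 1 * (a * G)) + L * (\<eta> 1)\<^sup>2 * G\<^sup>2"
    using objective_descent[of w0 "\<eta> 1" "d 0"] by simp
  moreover have "2 * (\<eta> 1 * (a * G)) \<le> a\<^sup>2 / L + L * (\<eta> 1)\<^sup>2 * G\<^sup>2"
  proof -
    have "a\<^sup>2 / L + L * (\<eta> 1)\<^sup>2 * G\<^sup>2 - 2 * (\<eta> 1 * (a * G)) = (a - L * \<eta> 1 * G)\<^sup>2 / L"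
      using L_pos by (simp add: field_simps power2_eq_square)
    moreover have "0 \<le> (a - L * \<eta> 1 * G)\<^sup>2 / L"
      using L_pos by simp
    ultimately show ?thesis by linarith
  qed
  ultimately show ?thesis
    by (simp add: a_def)
qed

text \<open>
  The step-size weighted sum of squared gradient norms at the starting points of the epochs. The cubes
  come from \<open>\<eta> t * (\<eta> (t - 1))\<^sup>2 \<le> \<eta> (t - 1) ^ 3\<close>.
\<close>

theorem weighted_gradient_sum_le:
  assumes "\<eta> 1 \<le> 1 / L" "T \<ge> 1"
  shows "2 * F (x (T * n)) + (\<Sum>t = 1..T. \<eta> t * (norm (gradient F (x ((t - 1) * n))))\<^sup>2)
    \<le> 2 * F w0 + (1 / L + \<eta> 1) * (norm (gradient F w0))\<^sup>2 + 2 * L * (\<eta> 1)\<^sup>2 * G\<^sup>2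
      + 4 * \<beta> ^ n * G\<^sup>2 * (\<Sum>t = 1..T. \<eta> t) + L\<^sup>2 * G\<^sup>2 * (\<Sum>t = 2..T. \<eta> (t - 1) ^ 3)"
  using assms(2)
proof (induction T rule: nat_induct_at_least)
  case base
  have "0 \<le> 4 * \<beta> ^ n * G\<^sup>2 * \<eta> 1"
    using beta_nonneg eta_pos[of 1] by simp
  then show ?case
    using first_epoch by (simp add: x_0 algebra_simps)
next
  case (Suc T)
  then obtain s where s: "T = Suc s"
    using not0_implies_Suc by force
  let ?h = "\<eta> (Suc T)" and ?D = "gradient F (x (T * n))"
  have h: "0 < ?h" "?h \<le> \<eta> T" "?h \<le> 1 / L"
    using Suc.hyps eta_pos eta_antimono[of 1 "Suc T"] eta_antimono[of T "Suc T"] assms(1) by auto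
  have "2 * F (x (Suc T * n)) + ?h * (norm ?D)\<^sup>2 \<le> 2 * F (x (T * n)) + ?h * (norm (?D - d T))\<^sup>2"
    unfolding x_epoch_Suc using h by (intro objective_descent_inexact) auto
  also have "?h * (norm (?D - d T))\<^sup>2 \<le> ?h * (4 * \<beta> ^ n * G\<^sup>2 + L\<^sup>2 * G\<^sup>2 * (\<eta> T)\<^sup>2)"
    using direction_error[of s] h unfolding s by (intro mult_left_mono) auto
  also have "\<dots> \<le> 4 * \<beta> ^ n * G\<^sup>2 * ?h + L\<^sup>2 * G\<^sup>2 * \<eta> T ^ 3"
  proof -
    have "(L\<^sup>2 * G\<^sup>2 * (\<eta> T)\<^sup>2) * ?h \<le> (L\<^sup>2 * G\<^sup>2 * (\<eta> T)\<^sup>2) * \<eta> T"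
      using h by (intro mult_left_mono) auto
    then show ?thesis
      by (simp add: algebra_simps power2_eq_square power3_eq_cube)
  qed
  finally show ?case
    using Suc by (simp add: distrib_left)
qed

end

section \<open>Expectation over the permutation and the output index\<close>

lemma pmf_smg_index:
  assumes "T \<ge> 1" "\<And>t. t \<ge> 1 \<Longrightarrow> \<eta> t > 0"
  shows "pmf (smg_index_pmf \<eta> T) t = (if t \<in> {1..T} then \<eta> t / (\<Sum>s = 1..T. \<eta> s) else 0)"
proof -
  let ?w = "\<lambda>t. if t \<in> {1..T} then \<eta> t / (\<Sum>s = 1..T. \<eta> s) else 0"
  have pos: "(\<Sum>s = 1..T. \<eta> s) > 0"
    using assms by (intro sum_pos) auto
  have nonneg: "?w t \<ge> 0" for t
    using assms(2) pos by (auto intro!: divide_nonneg_nonneg less_imp_le)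
  have "(\<integral>\<^sup>+t. ennreal (?w t) \<partial>count_space UNIV) = (\<Sum>t = 1..T. ennreal (?w t))"
    by (rule nn_integral_count_space') auto
  also have "\<dots> = ennreal (\<Sum>t = 1..T. ?w t)"
    by (rule sum_ennreal[OF nonneg])
  also have "(\<Sum>t = 1..T. ?w t) = (\<Sum>t = 1..T. \<eta> t / (\<Sum>s = 1..T. \<eta> s))"
    by (intro sum.cong) auto
  also have "\<dots> = 1"
    using pos by (simp flip: sum_divide_distrib)
  finally have "(\<integral>\<^sup>+t. ennreal (?w t) \<partial>count_space UNIV) = 1"
    by simp
  with nonneg show ?thesis
    unfolding smg_index_pmf_def by (rule pmf_embed_pmf)
qed

text \<open>
  A bound on the weighted mean over the epochs that holds for every possible permutation also holds
  for the expectation, by independence of the output index.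
\<close>

lemma expectation_smg_output_le:
  assumes fin: "finite (set_pmf P)" and T: "T \<ge> 1" and pos: "\<And>t. t \<ge> 1 \<Longrightarrow> \<eta> t > 0"
    and bound: "\<And>\<pi>. \<pi> \<in> set_pmf P \<Longrightarrow>
      (\<Sum>t = 1..T. \<eta> t * h (smg_iterate n f \<beta> \<eta> w0 \<pi> (t - 1))) \<le> B * (\<Sum>t = 1..T. \<eta> t)"
  shows "measure_pmf.expectation (smg_output n f \<beta> \<eta> w0 P T) h \<le> (B::real)"
proof -
  let ?S = "\<Sum>t = 1..T. \<eta> t" and ?w = "\<lambda>\<pi> t. smg_iterate n f \<beta> \<eta> w0 \<pi> (t - 1)"
  note index = pmf_smg_index[where \<eta> = \<eta>, OF T pos]
  have S: "?S > 0"
    using T pos by (intro sum_pos) auto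
  have "measure_pmf.expectation (smg_output n f \<beta> \<eta> w0 P T) h =
      measure_pmf.expectation (pair_pmf P (smg_index_pmf \<eta> T)) (\<lambda>(\<pi>, t). h (?w \<pi> t))"
    by (simp add: smg_output_def case_prod_unfold)
  also have "\<dots> = (\<Sum>a\<in>set_pmf P \<times> {1..T}.
      (case a of (\<pi>, t) \<Rightarrow> h (?w \<pi> t)) * pmf (pair_pmf P (smg_index_pmf \<eta> T)) a)"
    using fin by (intro integral_measure_pmf_real) (auto simp: set_pmf_iff index split: if_splits)
  also have "\<dots> = (\<Sum>(\<pi>, t)\<in>set_pmf P \<times> {1..T}.
      h (?w \<pi> t) * pmf (pair_pmf P (smg_index_pmf \<eta> T)) (\<pi>, t))"
    by (intro sum.cong) auto
  also have "\<dots> = (\<Sum>\<pi>\<in>set_pmf P. pmf P \<pi> * ((\<Sum>t = 1..T. \<eta> t * h (?w \<pi> t)) / ?S))"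
    by (simp add: pmf_pair index sum_distrib_left sum_divide_distrib ac_simps
        flip: sum.cartesian_product)
  also have "\<dots> \<le> (\<Sum>\<pi>\<in>set_pmf P. pmf P \<pi> * B)"
    using bound S by (intro sum_mono mult_left_mono) (auto simp: divide_le_eq)
  also have "\<dots> = B"
    using sum_pmf_eq_1[OF fin, of P] by (simp flip: sum_distrib_right)
  finally show ?thesis .
qed

section \<open>Step sizes decaying like the inverse cube root\<close>

lemma powr_two_thirds_increment_le:
  assumes "0 < (y::real)"
  shows "(y + 1) powr (2/3) - y powr (2/3) \<le> 1 / y powr (1/3)"
proof -
  have quot: "z powr (2/3) = z / z powr (1/3)" if "0 < z" for z :: real
    using powr_diff[of z 1 "1/3"] that by simp
  have "(y + 1) powr (2/3) = (y + 1) / (y + 1) powr (1/3)"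
    using assms by (intro quot) auto
  also have "\<dots> \<le> (y + 1) / y powr (1/3)"
    using assms by (intro divide_left_mono powr_mono2 mult_pos_pos) auto
  finally show ?thesis
    using quot[OF assms] by (simp add: add_divide_distrib)
qed

lemma sum_inverse_cbrt_ge:
  fixes lam :: real
  assumes "lam \<ge> 0" "T \<ge> 1"
  shows "(real T + lam) powr (2/3) - (1 + lam) powr (2/3) \<le> (\<Sum>t = 1..T. 1 / (real t + lam) powr (1/3))"
proof -
  have "(real T + lam) powr (2/3) - (1 + lam) powr (2/3) \<le> (\<Sum>t = 1..<T. 1 / (real t + lam) powr (1/3))"
    using assms(2)
  proof (induction T rule: nat_induct_at_least)
    case (Suc T)
    then show ?case
      using powr_two_thirds_increment_le[of "real T + lam"] assms(1) by (simp add: ac_simps)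
  qed simp
  also have "\<dots> \<le> (\<Sum>t = 1..T. 1 / (real t + lam) powr (1/3))"
    by (intro sum_mono2) auto
  finally show ?thesis .
qed

lemma sum_inverse_le_ln:
  fixes lam :: real
  assumes "lam \<ge> 0" "T \<ge> 2"
  shows "(\<Sum>t = 2..T. 1 / (real (t - 1) + lam)) \<le> 2 / (1 + lam) + ln (real T - 1 + lam)"
proof -
  have "(\<Sum>t = 2..T. 1 / (real (t - 1) + lam)) \<le>
      1 / (1 + lam) + (ln (real T - 1 + lam) - ln (1 + lam))"
    using assms(2)
  proof (induction T rule: nat_induct_at_least)
    case (Suc T)
    then show ?case
      using ln_diff_le[of "real T - 1 + lam" "real T + lam"] assms(1) by simp
  qed simp
  moreover have "0 \<le> 1 / (1 + lam)" "0 \<le> ln (1 + lam)"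
    using assms(1) by auto
  moreover have "2 / (1 + lam) = 1 / (1 + lam) + 1 / (1 + lam)"
    by (simp flip: add_divide_distrib)
  ultimately show ?thesis by linarith
qed

lemma two_thirds_gap_pos:
  fixes lam :: real
  assumes "lam \<ge> 0" "T \<ge> 2"
  shows "(real T + lam) powr (2/3) - (1 + lam) powr (2/3) > 0"
  using assms powr_less_mono2[of "2/3" "1 + lam" "real T + lam"] by simp

context smooth_finite_sum
begin

text \<open>
  The quantitative bound for diminishing step sizes. The momentum parameter enters only through
  \<open>\<beta> ^ n\<close>, without a factor \<open>1 / (1 - \<beta> ^ n)\<close>.
\<close>

theorem expectation_norm_gradient_le:
  fixes \<eta> :: "nat \<Rightarrow> real" and P :: "(nat \<Rightarrow> nat) pmf"
  assumes bdd: "bdd_below (range F)"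
    and T: "T \<ge> 2"
    and perms: "set_pmf P \<subseteq> {\<pi>. \<pi> permutes {1..n}}"
    and beta: "0 \<le> \<beta>" "\<beta> \<le> 1"
    and \<gamma>: "\<gamma> > 0" and lam: "lam \<ge> 0"
    and \<eta>_eq: "\<And>t. t \<ge> 1 \<Longrightarrow> \<eta> t = \<gamma> / (real t + lam) powr (1/3)"
    and \<eta>_1: "\<eta> 1 \<le> 1 / L"
  shows "measure_pmf.expectation (smg_output n f \<beta> \<eta> w0 P T) (\<lambda>w. (norm (gradient F w))\<^sup>2) \<le>
    ((2 * (F w0 - (INF w. F w)) + (1 / L + \<eta> 1) * (norm (gradient F w0))\<^sup>2
        + 2 * L * (\<eta> 1)\<^sup>2 * G\<^sup>2) / \<gamma> + 2 / (1 + lam) * L\<^sup>2 * G\<^sup>2 * \<gamma>\<^sup>2)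
      / ((real T + lam) powr (2/3) - (1 + lam) powr (2/3))
    + 4 * \<beta> ^ n * G\<^sup>2
    + L\<^sup>2 * G\<^sup>2 * \<gamma>\<^sup>2 * ln (real T - 1 + lam)
      / ((real T + lam) powr (2/3) - (1 + lam) powr (2/3))"
    (is "_ \<le> (?\<Delta> / \<gamma> + ?c) / ?D + ?b + ?l / ?D")
proof -
  define S where "S = (\<Sum>t = 1..T. \<eta> t)"
  define C where "C = ?\<Delta> + L\<^sup>2 * G\<^sup>2 * (\<gamma> ^ 3 * (2 / (1 + lam) + ln (real T - 1 + lam)))"
  have D: "?D > 0"
    using two_thirds_gap_pos lam T by blast
  have S_eq: "S = \<gamma> * (\<Sum>t = 1..T. 1 / (real t + lam) powr (1/3))"
    by (simp add: S_def \<eta>_eq sum_distrib_left)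
  have S: "\<gamma> * ?D \<le> S"
    unfolding S_eq using sum_inverse_cbrt_ge[of lam T] lam T \<gamma> by (intro mult_left_mono) auto
  have eta_pos: "\<eta> t > 0" if "t \<ge> 1" for t
    using that \<gamma> lam by (simp add: \<eta>_eq)
  have eta_antimono: "\<eta> t \<le> \<eta> s" if "1 \<le> s" "s \<le> t" for s t
    using that \<gamma> lam by (simp add: \<eta>_eq) (intro divide_left_mono powr_mono2 mult_pos_pos, auto)
  have F_ge: "(INF w. F w) \<le> F w" for w
    using bdd by (intro cINF_lower) auto
  have "0 \<le> ln (real T - 1 + lam)"
    using T lam by (intro ln_ge_zero) auto
  then have C_nonneg: "0 \<le> C"
    unfolding C_def using F_ge[of w0] L_pos eta_pos[of 1] \<gamma> lam
    by (intro add_nonneg_nonneg mult_nonneg_nonneg) auto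
  have cubes: "(\<Sum>t = 2..T. \<eta> (t - 1) ^ 3) \<le> \<gamma> ^ 3 * (2 / (1 + lam) + ln (real T - 1 + lam))"
  proof -
    have "\<eta> (t - 1) ^ 3 = \<gamma> ^ 3 * (1 / (real (t - 1) + lam))" if "2 \<le> t" for t
    proof -
      have "((real (t - 1) + lam) powr (1/3)) ^ 3 = real (t - 1) + lam"
        using that lam by (simp add: powr_power)
      then show ?thesis
        using that by (simp add: \<eta>_eq power_divide)
    qed
    then have "(\<Sum>t = 2..T. \<eta> (t - 1) ^ 3) = \<gamma> ^ 3 * (\<Sum>t = 2..T. 1 / (real (t - 1) + lam))"
      by (simp add: sum_distrib_left)
    then show ?thesis
      using sum_inverse_le_ln[OF lam T] \<gamma> by simp
  qed
  have "(\<Sum>t = 1..T. \<eta> t * (norm (gradient F (smg_iterate n f \<beta> \<eta> w0 \<pi> (t - 1))))\<^sup>2)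
      \<le> (C / (\<gamma> * ?D) + ?b) * (\<Sum>t = 1..T. \<eta> t)" if "\<pi> \<in> set_pmf P" for \<pi>
  proof -
    interpret smg_run n f L G \<beta> \<eta> w0 \<pi>
      using that perms beta eta_pos eta_antimono by unfold_locales auto
    have "(\<Sum>t = 1..T. \<eta> t * (norm (gradient F (smg_iterate n f \<beta> \<eta> w0 \<pi> (t - 1))))\<^sup>2)
        \<le> ?\<Delta> + ?b * S + L\<^sup>2 * G\<^sup>2 * (\<Sum>t = 2..T. \<eta> (t - 1) ^ 3)"
      using weighted_gradient_sum_le[OF \<eta>_1, of T] T F_ge[of "x (T * n)"]
      by (simp add: iterate_eq_x S_def right_diff_distrib)
    also have "\<dots> \<le> C + ?b * S"
      using cubes by (simp add: C_def mult_left_mono)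
    also have "C \<le> C / (\<gamma> * ?D) * S"
    proof -
      have "C / (\<gamma> * ?D) * (\<gamma> * ?D) \<le> C / (\<gamma> * ?D) * S"
        using S C_nonneg \<gamma> D by (intro mult_left_mono) auto
      then show ?thesis
        using \<gamma> D by simp
    qed
    finally show ?thesis
      by (simp add: S_def distrib_right)
  qed
  then have "measure_pmf.expectation (smg_output n f \<beta> \<eta> w0 P T) (\<lambda>w. (norm (gradient F w))\<^sup>2)
      \<le> C / (\<gamma> * ?D) + ?b"
    using T eta_pos finite_subset[OF perms] finite_permutations[of "{1..n}"]
    by (intro expectation_smg_output_le) auto
  also have "C / (\<gamma> * ?D) = (?\<Delta> / \<gamma> + ?c) / ?D + ?l / ?D"
  proof -
    have "C / \<gamma> = ?\<Delta> / \<gamma> + ?c + ?l"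
    proof -
      have "(X + A * (\<gamma> ^ 3 * (Q + l))) / \<gamma> = X / \<gamma> + Q * A * \<gamma>\<^sup>2 + A * \<gamma>\<^sup>2 * l" for X A Q l :: real
        using \<gamma> by (simp add: field_simps power3_eq_cube power2_eq_square)
      from this[of ?\<Delta> "L\<^sup>2 * G\<^sup>2" "2 / (1 + lam)" "ln (real T - 1 + lam)"] show ?thesis
        by (simp only: C_def mult.assoc)
    qed
    then show ?thesis
      by (simp add: add_divide_distrib flip: divide_divide_eq_left)
  qed
  finally show ?thesis by simp
qed

end

section \<open>The convergence rate\<close>

lemma two_thirds_rate_bigo:
  fixes a b c lam :: real
  shows "(\<lambda>K. a / ((real K + lam) powr (2/3) - (1 + lam) powr (2/3)) + b / real K powr (2/3)
      + c * ln (real K - 1 + lam) / ((real K + lam) powr (2/3) - (1 + lam) powr (2/3)))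
    \<in> O(\<lambda>K. ln (real K) / real K powr (2/3))"
proof -
  have 1: "(\<lambda>K. 1 / ((real K + lam) powr (2/3) - (1 + lam) powr (2/3)))
      \<in> O(\<lambda>K. ln (real K) / real K powr (2/3))"
    by real_asymp
  have 2: "(\<lambda>K. 1 / real K powr (2/3)) \<in> O(\<lambda>K. ln (real K) / real K powr (2/3))"
    by real_asymp
  have 3: "(\<lambda>K. ln (real K - 1 + lam) / ((real K + lam) powr (2/3) - (1 + lam) powr (2/3)))
      \<in> O(\<lambda>K. ln (real K) / real K powr (2/3))"
    by real_asymp
  have cmult: "(\<lambda>K. r * h K) \<in> O(g)" if "h \<in> O(g)" for r :: real and g h :: "nat \<Rightarrow> real"
    using that by (cases "r = 0") auto
  have "(\<lambda>K. a * (1 / ((real K + lam) powr (2/3) - (1 + lam) powr (2/3)))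
      + b * (1 / real K powr (2/3))
      + c * (ln (real K - 1 + lam) / ((real K + lam) powr (2/3) - (1 + lam) powr (2/3))))
    \<in> O(\<lambda>K. ln (real K) / real K powr (2/3))"
    by (intro sum_in_bigo cmult 1 2 3)
  then show ?thesis by simp
qed

theorem corollary8:
  fixes f :: "nat \<Rightarrow> real ^ 'd \<Rightarrow> real"
    and F :: "real ^ 'd \<Rightarrow> real"
    and w0 :: "real ^ 'd"
    and n T :: nat
    and L G \<nu> R \<gamma> lam F_star D1 :: real
    and \<beta> \<eta> :: "nat \<Rightarrow> real"
    and P :: "nat \<Rightarrow> (nat \<Rightarrow> nat) pmf"
  assumes "n \<ge> 1"
    and "\<And>i w. i \<in> {1..n} \<Longrightarrow> f i differentiable (at w)"
    and F_eq: "F = objective n f"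
    and "bdd_below (range F)"
    and F_star_eq: "F_star = (INF w. F w)"
    and "L > 0"
    and "\<And>i w w'. i \<in> {1..n} \<Longrightarrow>
           norm (gradient (f i) w - gradient (f i) w') \<le> L * norm (w - w')"
    and "G > 0"
    and "\<And>i w. i \<in> {1..n} \<Longrightarrow> norm (gradient (f i) w) \<le> G"
    and "\<And>K. K \<ge> 1 \<Longrightarrow> set_pmf (P K) \<subseteq> {\<pi>. \<pi> permutes {1..n}}"
    and "T \<ge> 2"
    and "\<nu> \<ge> 0" and "R \<ge> 1"
    and \<beta>_eq: "\<And>K. K \<ge> 1 \<Longrightarrow> \<beta> K = (\<nu> / real K powr (2/3)) powr (1 / real n)"
    and "\<beta> T \<le> ((R - 1) / R) powr (1 / real n)"
    and "\<gamma> > 0" and "lam \<ge> 0"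
    and \<eta>_eq: "\<And>t. t \<ge> 1 \<Longrightarrow> \<eta> t = \<gamma> / (real t + lam) powr (1/3)"
    and "\<eta> 1 \<le> 1 / L"
    and D1_eq: "D1 = 2 * R / \<gamma> * (F w0 - F_star)
           + (R / (\<gamma> * L) + R / (1 + lam) powr (1/3)) * (norm (gradient F w0))\<^sup>2
           + 2 * R * L * \<gamma> * G\<^sup>2 / (1 + lam) powr (2/3)
           + 2 / (1 + lam) * L\<^sup>2 * G\<^sup>2 * \<gamma>\<^sup>2"
  shows "measure_pmf.expectation (smg_output n f (\<beta> T) \<eta> w0 (P T) T) (\<lambda>w. (norm (gradient F w))\<^sup>2)
           \<le> D1 / ((real T + lam) powr (2/3) - (1 + lam) powr (2/3))
             + 4 * \<nu> * G\<^sup>2 * R / real T powr (2/3)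
             + L\<^sup>2 * G\<^sup>2 * \<gamma>\<^sup>2 * ln (real T - 1 + lam)
                 / ((real T + lam) powr (2/3) - (1 + lam) powr (2/3))
         \<and> (\<lambda>K. measure_pmf.expectation (smg_output n f (\<beta> K) \<eta> w0 (P K) K)
                  (\<lambda>w. (norm (gradient F w))\<^sup>2))
             \<in> O(\<lambda>K. ln (real K) / real K powr (2/3))"
proof -
  define \<Delta> where "\<Delta> = 2 * (F w0 - F_star) + (1 / L + \<eta> 1) * (norm (gradient F w0))\<^sup>2
    + 2 * L * (\<eta> 1)\<^sup>2 * G\<^sup>2"
  define c where "c = 2 / (1 + lam) * L\<^sup>2 * G\<^sup>2 * \<gamma>\<^sup>2"
  let ?D = "\<lambda>K. (real K + lam) powr (2/3) - (1 + lam) powr (2/3)"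
  let ?E = "\<lambda>K. measure_pmf.expectation (smg_output n f (\<beta> K) \<eta> w0 (P K) K)
    (\<lambda>w. (norm (gradient F w))\<^sup>2)"
  let ?bound = "\<lambda>K. (\<Delta> / \<gamma> + c) / ?D K + 4 * \<nu> * G\<^sup>2 / real K powr (2/3)
    + L\<^sup>2 * G\<^sup>2 * \<gamma>\<^sup>2 * ln (real K - 1 + lam) / ?D K"
  interpret smooth_finite_sum n f L G
    using assms by unfold_locales auto
  have beta_nonneg: "0 \<le> \<beta> K" if "K \<ge> 1" for K
    using that by (simp add: \<beta>_eq)
  have beta_power: "\<beta> K ^ n = \<nu> / real K powr (2/3)" if "K \<ge> 1" for K
    using that \<open>n \<ge> 1\<close> \<open>\<nu> \<ge> 0\<close> by (cases "\<nu> = 0") (simp_all add: \<beta>_eq powr_power)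
  have E_le: "?E K \<le> ?bound K" if "K \<ge> 2" "\<beta> K \<le> 1" for K
    using expectation_norm_gradient_le[of K "P K" "\<beta> K" \<gamma> lam \<eta> w0] that assms(4,10,16,17,19)
      beta_nonneg[of K] beta_power[of K] \<eta>_eq
    by (simp add: F_eq F_star_eq \<Delta>_def c_def)
  have part1: "?E T \<le> D1 / ?D T + 4 * \<nu> * G\<^sup>2 * R / real T powr (2/3)
      + L\<^sup>2 * G\<^sup>2 * \<gamma>\<^sup>2 * ln (real T - 1 + lam) / ?D T"
  proof -
    have "((R - 1) / R) powr (1 / real n) \<le> 1"
      using \<open>R \<ge> 1\<close> by (intro powr_le1) auto
    then have "\<beta> T \<le> 1"
      using assms(15) by linarith
    then have "?E T \<le> ?bound T"
      using E_le \<open>T \<ge> 2\<close> by blast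
    \<comment> \<open>\<open>D1\<close> is \<open>R * (\<Delta> / \<gamma>) + c\<close>, and \<open>R \<ge> 1\<close>.\<close>
    moreover have "\<Delta> / \<gamma> + c \<le> D1"
    proof -
      have "F_star \<le> F w0"
        unfolding F_star_eq using assms(4) by (intro cINF_lower) auto
      then have "0 \<le> \<Delta> / \<gamma>"
        unfolding \<Delta>_def using \<open>L > 0\<close> \<open>\<gamma> > 0\<close> \<open>lam \<ge> 0\<close> \<eta>_eq[of 1]
        by (intro divide_nonneg_nonneg add_nonneg_nonneg mult_nonneg_nonneg) auto
      then have "\<Delta> / \<gamma> \<le> R * (\<Delta> / \<gamma>)"
        using \<open>R \<ge> 1\<close> mult_right_mono[of 1 R "\<Delta> / \<gamma>"] by simp
      moreover have "((1 + lam) powr (1/3))\<^sup>2 = (1 + lam) powr (2/3)"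
        using \<open>lam \<ge> 0\<close> by (simp add: powr_power)
      then have "R * (\<Delta> / \<gamma>) + c = D1"
        unfolding D1_eq \<Delta>_def c_def using \<open>\<gamma> > 0\<close> \<open>L > 0\<close> \<eta>_eq[of 1]
        by (simp add: power_divide add_divide_distrib distrib_left distrib_right
              power2_eq_square[of \<gamma>] right_diff_distrib ac_simps)
      ultimately show ?thesis by linarith
    qed
    then have "(\<Delta> / \<gamma> + c) / ?D T \<le> D1 / ?D T"
      using two_thirds_gap_pos[OF \<open>lam \<ge> 0\<close> \<open>T \<ge> 2\<close>] by (intro divide_right_mono) auto
    moreover have "4 * \<nu> * G\<^sup>2 * 1 / real T powr (2/3) \<le> 4 * \<nu> * G\<^sup>2 * R / real T powr (2/3)"
      using \<open>R \<ge> 1\<close> \<open>\<nu> \<ge> 0\<close> by (intro divide_right_mono mult_left_mono) auto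
    ultimately show ?thesis by simp
  qed
  \<comment> \<open>The hypothesis on \<open>\<beta> T\<close> concerns one \<open>T\<close> only; that \<open>\<beta> K \<le> 1\<close> for large \<open>K\<close> follows from the
    decay of \<open>\<nu> / K\<^bsup>2/3\<^esup>\<close>.\<close>
  have "eventually (\<lambda>K. \<nu> / real K powr (2/3) < 1) sequentially"
    by real_asymp
  then have "eventually (\<lambda>K. norm (?E K) \<le> norm (?bound K)) sequentially"
    using eventually_ge_at_top[of 2]
  proof eventually_elim
    case (elim K)
    have "\<beta> K \<le> 1"
      using elim \<open>\<nu> \<ge> 0\<close> by (simp add: \<beta>_eq powr_le1)
    then have "?E K \<le> ?bound K"
      using E_le elim by blast
    moreover have "0 \<le> ?E K"
      by (intro Bochner_Integration.integral_nonneg) auto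
    ultimately show ?case by simp
  qed
  then have "?E \<in> O(?bound)"
    by (rule landau_o.big_mono)
  also have "?bound \<in> O(\<lambda>K. ln (real K) / real K powr (2/3))"
    by (rule two_thirds_rate_bigo)
  finally show ?thesis
    using part1 by blast
qed

end
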